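(* Suppose $A \in \mathcal{M}_n^{+}$ has factor width $k \geq 2$ and all of its entries are non-zero. Then $\mathrm{fran}_k(A) \geq C(n,k,2)$. Furthermore, for all integers $2 \leq k \leq n$ there exists a matrix $A \in \mathcal{M}_n^{+}$ with factor width $k$ and all entries non-zero for which $\mathrm{fran}_k(A) = C(n,k,2)$.
   Context: Let $\mathbb{F} \in \{\mathbb{R},\mathbb{C}\}$ (the result holds for either field). $\mathcal{M}_n^{+}$ denotes the set of $n \times n$ positive semidefinite (real symmetric if $\mathbb{F}=\mathbb{R}$, Hermitian if $\mathbb{F}=\mathbb{C}$) matrices over $\mathbb{F}$. The factor width of $A \in \mathcal{M}_n^{+}$ is the smallest positive integer $k$ such that $A = \sum_{j=1}^r \mathbf{v}_j\mathbf{v}_j^*$ for some $r$ and some $\mathbf{v}_1,\ldots,\mathbf{v}_r \in \mathbb{F}^n$, each with at most $k$ non-zero entries. If $A$ has factor width at most $k$, $\mathrm{fran}_k(A)$ (the factor-width-$k$ rank) is the least integer $r$ for which such a decomposition with vectors having at most $k$ non-zero entries exists. For positive integers $t \leq k \leq n$, an $(n,k,t)$-covering design is a collection of $k$-element subsets of $[n]=\{1,\ldots,n\}$ such that every $t$-element subset of $[n]$ is contained in at least one of them; $C(n,k,t)$ is the minimum number of $k$-element subsets in an $(n,k,t)$-covering design. *)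

theory Defs
  imports "Jordan_Normal_Form.Schur_Decomposition"
begin

text \<open>
  The notions below are generic in the scalar type and are meant to be used at types
  \<^typ>\<open>real\<close> (where \<^const>\<open>conjugate\<close> is the identity) and \<^typ>\<open>complex\<close>. On complex numbers,
  \<open>0 \<le> z\<close> says that \<open>z\<close> is real and non-negative.
\<close>

text \<open>
  The explicit symmetry condition is redundant for complex matrices but not for real ones.
  The product \<open>(A *\<^sub>v v) \<bullet>c v\<close> is \<open>v\<^sup>* A v\<close>.
\<close>

definition psd_mats :: "nat \<Rightarrow> 'a :: conjugatable_ordered_field mat set" where
  "psd_mats n = {A \<in> carrier_mat n n.
     mat_adjoint A = A \<and> (\<forall>v \<in> carrier_vec n. 0 \<le> (A *\<^sub>v v) \<bullet>c v)}"

definition nonzero_entries :: "'a :: zero mat \<Rightarrow> bool" where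
  "nonzero_entries A \<longleftrightarrow> (\<forall>i < dim_row A. \<forall>j < dim_col A. A $$ (i, j) \<noteq> 0)"

definition supp_vec :: "'a :: zero vec \<Rightarrow> nat set" where
  "supp_vec v = {i. i < dim_vec v \<and> v $ i \<noteq> 0}"

definition outer_self :: "'a :: conjugatable_field vec \<Rightarrow> 'a mat" where
  "outer_self v = mat (dim_vec v) (dim_vec v) (\<lambda>(i, j). v $ i * conjugate (v $ j))"

text \<open>
  \<open>A = v\<^sub>1 v\<^sub>1\<^sup>* + \<dots> + v\<^sub>r v\<^sub>r\<^sup>*\<close> for the list \<open>vs = [v\<^sub>1, \<dots>, v\<^sub>r]\<close>. The sum is a fold because
  \<^typ>\<open>'a mat\<close> has no zero element independent of the dimensions.
\<close>

definition width_decomp :: "nat \<Rightarrow> 'a :: conjugatable_field mat \<Rightarrow> 'a vec list \<Rightarrow> bool" where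
  "width_decomp k A vs \<longleftrightarrow>
     (\<forall>v \<in> set vs. v \<in> carrier_vec (dim_row A) \<and> card (supp_vec v) \<le> k) \<and>
     A = foldr (+) (map outer_self vs) (0\<^sub>m (dim_row A) (dim_row A))"

definition factor_width :: "'a :: conjugatable_field mat \<Rightarrow> nat" where
  "factor_width A = (LEAST k. 0 < k \<and> (\<exists>vs. width_decomp k A vs))"

text \<open>Meaningful only if \<open>A\<close> has factor width at most \<open>k\<close>.\<close>

definition fran :: "nat \<Rightarrow> 'a :: conjugatable_field mat \<Rightarrow> nat" where
  "fran k A = (LEAST r. \<exists>vs. width_decomp k A vs \<and> length vs = r)"

text \<open>
  The points are \<open>0, \<dots>, n - 1\<close>, which are also the row and column indices of an
  \<open>n \<times> n\<close> matrix.
\<close>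

definition covering_design :: "nat \<Rightarrow> nat \<Rightarrow> nat \<Rightarrow> nat set set \<Rightarrow> bool" where
  "covering_design n k t \<B> \<longleftrightarrow>
     (\<forall>B \<in> \<B>. B \<subseteq> {..<n} \<and> card B = k) \<and>
     (\<forall>T. T \<subseteq> {..<n} \<and> card T = t \<longrightarrow> (\<exists>B \<in> \<B>. T \<subseteq> B))"

text \<open>Meaningful only for \<open>1 \<le> t \<le> k \<le> n\<close>; otherwise there may be no covering design.\<close>

definition covering_number :: "nat \<Rightarrow> nat \<Rightarrow> nat \<Rightarrow> nat" where
  "covering_number n k t = (LEAST c. \<exists>\<B>. covering_design n k t \<B> \<and> card \<B> = c)"

end

theory Submission
  imports Defs
begin

text \<open>
  The lower bound. If \<open>A = \<Sum>v. v v\<^sup>*\<close> has no zero entry, then for all \<open>i \<noteq> j\<close> some \<open>v\<close> in the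
  sum has \<open>v\<^sub>i \<noteq> 0\<close> and \<open>v\<^sub>j \<noteq> 0\<close>. The supports of the vectors therefore cover all pairs, and
  enlarging each of them to exactly \<open>k\<close> points gives a covering design with no more blocks than
  there are vectors (\<open>covering_number_le_length\<close>). To apply this to a decomposition that attains
  \<open>fran k A\<close>, one has to know that decompositions exist and that \<open>k \<le> n\<close>; both follow from the
  fact that every positive semidefinite matrix is a Gram matrix (\<open>psd_on_gram\<close>), proved by
  eliminating one row and column at a time as in the Cholesky algorithm.

  Equality. Let \<open>\<B>\<close> be a minimum covering design and let \<open>A\<close> be the sum of the matrices
  \<open>v\<^sub>B v\<^sub>B\<^sup>*\<close>, \<open>B \<in> \<B>\<close>, where \<open>v\<^sub>B\<close> is a positive multiple of the indicator vector of \<open>B\<close>.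
  All entries of \<open>A\<close> are positive and \<open>A\<close> is a sum of \<open>C(n,k,2)\<close> matrices of the required form, so
  by the lower bound only one thing is left: the factor width of \<open>A\<close> must not be smaller than \<open>k\<close>.
  This is achieved by giving one block \<open>S\<close> a large weight. The matrix of ones on \<open>S\<close> is extremal
  with factor width \<open>k\<close>, and it is separated from all matrices of smaller factor width by the
  linear functional
  \<open>L(A) = 2 (k - 1) (\<Sum>i\<in>S. A\<^sub>i\<^sub>i) - 2 (\<Sum>i\<in>S. \<Sum>j\<in>S. A\<^sub>i\<^sub>j)\<close>.
  It is non-negative on \<open>w w\<^sup>*\<close> whenever \<open>w\<close> vanishes somewhere on \<open>S\<close> (\<open>width_test_nonneg\<close>), and it is
  negative on the matrix of ones on \<open>S\<close>, so a large enough weight on \<open>S\<close> makes \<open>L(A)\<close> negative.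

  Both fields are treated at once; besides the order, what matters about the scalars is that
  every non-negative one has the form \<open>b * conjugate b\<close>.
\<close>

section \<open>Scalars\<close>

text \<open>
  Applied to a pivot \<open>a\<close>, the axiom gives the diagonal entry \<open>b\<close> of the Cholesky factor. The order on the complex numbers is only
  partial, so nothing below may compare two arbitrary scalars.
\<close>

class square_closed_field = conjugatable_ordered_field + ordered_comm_ring + field_char_0 +
  assumes nonneg_is_square: "0 \<le> a \<Longrightarrow> \<exists>b. b * conjugate b = a"

instance real :: square_closed_field
proof
  fix a :: real assume "0 \<le> a"
  then show "\<exists>b. b * conjugate b = a" by (intro exI[of _ "sqrt a"]) simp
qed

instance complex :: square_closed_field
proof
  fix a :: complex assume "0 \<le> a"
  then have "a = complex_of_real (sqrt (Re a)) * conjugate (complex_of_real (sqrt (Re a)))"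
    by (simp add: less_eq_complex_def complex_eq_iff)
  then show "\<exists>b. b * conjugate b = a" by metis
qed

lemma conjugate_one [simp]: "conjugate (1 :: 'a :: conjugatable_field) = 1"
proof -
  have "conjugate (1 :: 'a) * conjugate 1 = conjugate 1"
    by (metis conjugate_dist_mul mult_1)
  then show ?thesis by simp
qed

lemma conjugate_diff: "conjugate (x - y :: 'a :: conjugatable_ring) = conjugate x - conjugate y"
  by (simp only: diff_conv_add_uminus conjugate_dist_add conjugate_neg)

lemma conjugate_divide:
  "conjugate (x / y :: 'a :: conjugatable_field) = conjugate x / conjugate y"
proof (cases "y = 0")
  case False
  then have "conjugate (x / y) * conjugate y = conjugate x"
    by (simp flip: conjugate_dist_mul)
  then show ?thesis using False by (simp add: eq_divide_eq)
qed simp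

lemma conjugate_of_nat [simp]: "conjugate (of_nat n :: 'a :: conjugatable_field) = of_nat n"
  by (induction n) (simp_all add: conjugate_dist_add)

lemma of_nat_nonneg_in_field: "0 \<le> (of_nat n :: 'a :: square_closed_field)"
proof -
  have "(0 :: 'a) \<le> 1" using conjugate_square_positive[of "1 :: 'a"] by simp
  then show ?thesis by (induction n) simp_all
qed

text \<open>Signs of integer matrix expressions can be read off in \<open>int\<close>, where the order is linear.\<close>

lemma of_int_nonneg_iff_in_field: "0 \<le> (of_int z :: 'a :: square_closed_field) \<longleftrightarrow> 0 \<le> z"
proof
  assume z: "0 \<le> (of_int z :: 'a)"
  show "0 \<le> z"
  proof (rule ccontr)
    assume neg: "\<not> 0 \<le> z"
    then have "(of_int z :: 'a) = - of_nat (nat (- z))" by simp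
    then have "(of_int z :: 'a) \<le> 0" using of_nat_nonneg_in_field by (metis neg_le_0_iff_le)
    with z have "(of_int z :: 'a) = 0" by (rule order.antisym[rotated])
    with neg show False by simp
  qed
next
  assume "0 \<le> z"
  then have "(of_int z :: 'a) = of_nat (nat z)" by simp
  then show "0 \<le> (of_int z :: 'a)" using of_nat_nonneg_in_field by metis
qed

section \<open>Positive semidefinite matrices are sums of rank-one matrices\<close>

text \<open>
  Matrices are functions on an arbitrary index set here, so that an elimination step is the passage
  from \<open>insert a S\<close> to \<open>S\<close> and no block matrices are needed. \<open>hform S A x\<close> is \<open>x\<^sup>* A x\<close>.
\<close>

definition hform :: "'i set \<Rightarrow> ('i \<Rightarrow> 'i \<Rightarrow> 'a :: conjugatable_field) \<Rightarrow> ('i \<Rightarrow> 'a) \<Rightarrow> 'a" where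
  "hform S A x = (\<Sum>i\<in>S. \<Sum>j\<in>S. A i j * x j * conjugate (x i))"

definition psd_on :: "'i set \<Rightarrow> ('i \<Rightarrow> 'i \<Rightarrow> 'a :: conjugatable_ordered_field) \<Rightarrow> bool" where
  "psd_on S A \<longleftrightarrow> (\<forall>i\<in>S. \<forall>j\<in>S. A j i = conjugate (A i j)) \<and> (\<forall>x. 0 \<le> hform S A x)"

lemma psd_onD:
  "psd_on S A \<Longrightarrow> i \<in> S \<Longrightarrow> j \<in> S \<Longrightarrow> A j i = conjugate (A i j)"
  "psd_on S A \<Longrightarrow> 0 \<le> hform S A x"
  unfolding psd_on_def by blast+

text \<open>A vector on \<open>T\<close> extends by zero to \<open>S\<close> without changing the value of the form.\<close>

lemma psd_on_subset:
  assumes A: "psd_on S A" and "T \<subseteq> S" "finite S"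
  shows "psd_on T A"
proof -
  have "0 \<le> hform T A x" for x
  proof -
    let ?y = "\<lambda>i. if i \<in> T then x i else 0"
    have "hform S A ?y = (\<Sum>i\<in>T. \<Sum>j\<in>S. A i j * ?y j * conjugate (?y i))"
      unfolding hform_def using assms by (intro sum.mono_neutral_right) auto
    also have "\<dots> = (\<Sum>i\<in>T. \<Sum>j\<in>T. A i j * ?y j * conjugate (?y i))"
      using assms by (intro sum.cong refl sum.mono_neutral_right) auto
    also have "\<dots> = hform T A x" by (simp add: hform_def)
    finally show ?thesis using psd_onD(2)[OF A, of ?y] by simp
  qed
  moreover have "A j i = conjugate (A i j)" if "i \<in> T" "j \<in> T" for i j
    using psd_onD(1)[OF A] that assms(2) by blast
  ultimately show ?thesis unfolding psd_on_def by blast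
qed

lemma hform_insert:
  assumes "finite S" "a \<notin> S" "\<And>i. i \<in> S \<Longrightarrow> A i a = conjugate (A a i)"
  defines "r \<equiv> \<lambda>x. \<Sum>j\<in>S. A a j * x j"
  shows "hform (insert a S) A x = A a a * x a * conjugate (x a) + r x * conjugate (x a)
           + x a * conjugate (r x) + hform S A x"
proof -
  have 1: "(\<Sum>i\<in>S. A i a * x a * conjugate (x i)) = x a * conjugate (r x)"
    unfolding r_def sum_conjugate[OF assms(1)] sum_distrib_left
    by (intro sum.cong refl) (simp only: assms(3) conjugate_dist_mul mult_ac)
  have 2: "(\<Sum>j\<in>S. A a j * x j * conjugate (x a)) = r x * conjugate (x a)"
    unfolding r_def by (rule sum_distrib_right[symmetric])
  have "hform (insert a S) A x = (A a a * x a * conjugate (x a) + (\<Sum>j\<in>S. A a j * x j * conjugate (x a)))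
      + ((\<Sum>i\<in>S. A i a * x a * conjugate (x i)) + hform S A x)"
    unfolding hform_def by (simp only: sum.insert[OF assms(1,2)] sum.distrib add_ac)
  then show ?thesis unfolding 1 2 by (simp only: add.assoc)
qed

text \<open>
  If \<open>A a a = 0\<close>, the form restricted to \<open>{a, j}\<close> is affine in the coordinate at \<open>a\<close>, and a non-zero
  slope \<open>A a j\<close> would make it take negative values.
\<close>

lemma psd_on_zero_diag:
  fixes A :: "'i \<Rightarrow> 'i \<Rightarrow> 'a :: square_closed_field"
  assumes A: "psd_on S A" and S: "finite S" "a \<in> S" "j \<in> S" and zero: "A a a = 0"
  shows "A a j = 0"
proof (rule ccontr)
  assume nz: "A a j \<noteq> 0"
  with zero have "a \<noteq> j" by auto
  have A2: "psd_on {a, j} A" using psd_on_subset[OF A] S by simp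
  have "0 \<le> hform {j} A (\<lambda>_. 1)" using psd_on_subset[OF A] S psd_onD(2) by blast
  then have d0: "0 \<le> A j j" by (simp add: hform_def)
  have dc: "conjugate (A j j) = A j j" using psd_onD(1)[OF A, of j j] S by simp
  \<comment> \<open>Scaled so that the two cross terms add up to \<open>- 2 (A j j + 1)\<close>, which outweighs \<open>A j j\<close>.\<close>
  define u where "u = (A j j + 1) / conjugate (A a j)"
  have u: "A a j * conjugate u = A j j + 1" "u * conjugate (A a j) = A j j + 1"
    using nz by (simp_all add: u_def conjugate_divide conjugate_dist_add dc)
  let ?x = "\<lambda>i. if i = a then - u else (1 :: 'a)"
  have "hform {a, j} A ?x = - A j j - 2"
    using \<open>a \<noteq> j\<close> zero psd_onD(1)[OF A2, of a j]
    by (subst hform_insert) (auto simp: hform_def conjugate_neg u)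
  then have "0 \<le> - A j j - 2" using psd_onD(2)[OF A2, of ?x] by simp
  then have "0 \<le> (- A j j - 2) + A j j" using d0 by (intro add_nonneg_nonneg)
  then have "0 \<le> (of_int (- 2) :: 'a)" by simp
  then show False unfolding of_int_nonneg_iff_in_field by simp
qed

text \<open>
  Completing the square: for fixed \<open>x\<close> on \<open>S\<close>, the minimum of the form of \<open>A\<close> over the coordinate at
  \<open>a\<close> is exactly the value at \<open>x\<close> of the form of the Schur complement.
\<close>

lemma psd_on_schur_complement:
  fixes A :: "'i \<Rightarrow> 'i \<Rightarrow> 'a :: square_closed_field"
  assumes A: "psd_on (insert a S) A" and S: "finite S" "a \<notin> S"
    and b: "b * conjugate b = A a a" "b \<noteq> 0"
  defines "v \<equiv> \<lambda>i. A i a / conjugate b"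
  shows "psd_on S (\<lambda>i j. A i j - v i * conjugate (v j))"
proof -
  let ?A = "\<lambda>i j. A i j - v i * conjugate (v j)"
  have herm: "A j i = conjugate (A i j)" if "i \<in> insert a S" "j \<in> insert a S" for i j
    using psd_onD(1)[OF A that] .
  have "0 \<le> hform S ?A x" for x
  proof -
    define r where "r = (\<Sum>j\<in>S. A a j * x j)"
    \<comment> \<open>The minimizing coordinate at \<open>a\<close>.\<close>
    let ?y = "x(a := - r / A a a)"
    have ry: "(\<Sum>j\<in>S. A a j * ?y j) = r"
      unfolding r_def using S by (intro sum.cong) auto
    have hy: "hform S A ?y = hform S A x"
      unfolding hform_def using S by (intro sum.cong) auto
    have caa: "conjugate (A a a) = A a a" using herm[of a a] by simp
    have aa: "A a a \<noteq> 0" using b by auto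
    have 1: "(\<Sum>i\<in>S. v i * conjugate (x i)) = conjugate r / conjugate b"
      unfolding r_def v_def sum_conjugate[OF S(1)] sum_divide_distrib
      by (intro sum.cong) (auto simp: conjugate_dist_mul herm[of a])
    have 2: "(\<Sum>j\<in>S. conjugate (v j) * x j) = r / b"
      unfolding r_def v_def sum_divide_distrib
      by (intro sum.cong) (auto simp: conjugate_divide herm[of a])
    have "hform S ?A x = hform S A x
        - (\<Sum>i\<in>S. v i * conjugate (x i)) * (\<Sum>j\<in>S. conjugate (v j) * x j)"
      unfolding hform_def sum_product
      by (simp add: sum_subtractf algebra_simps)
    also have "\<dots> = hform S A x - conjugate r * r / A a a"
      unfolding 1 2 using b by (auto simp: field_simps)
    also have "\<dots> = hform (insert a S) A ?y"
    proof -
      have "hform (insert a S) A ?y = A a a * ?y a * conjugate (?y a) + r * conjugate (?y a)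
          + ?y a * conjugate r + hform S A x"
        using hform_insert[OF S, of A ?y] herm[of a] unfolding ry hy by blast
      also have "\<dots> = hform S A x - conjugate r * r / A a a"
        using aa by (simp add: conjugate_divide conjugate_neg caa field_simps)
      finally show ?thesis by simp
    qed
    finally show ?thesis using psd_onD(2)[OF A] by simp
  qed
  moreover have "?A j i = conjugate (?A i j)" if "i \<in> S" "j \<in> S" for i j
    using herm[of i j] that by (simp add: conjugate_diff conjugate_dist_mul mult.commute)
  ultimately show ?thesis unfolding psd_on_def by blast
qed

text \<open>
  Cholesky elimination: subtract one rank-one matrix that clears row and column \<open>a\<close>, unless they
  vanish already, and recurse on the rest.
\<close>

lemma psd_on_gram:
  fixes A :: "'i \<Rightarrow> 'i \<Rightarrow> 'a :: square_closed_field"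
  assumes "finite S" "psd_on S A"
  shows "\<exists>ws. \<forall>i\<in>S. \<forall>j\<in>S. A i j = (\<Sum>w\<leftarrow>ws. w i * conjugate (w j))"
  using assms
proof (induction S arbitrary: A rule: finite_induct)
  case (insert a S)
  \<comment> \<open>The vectors given for \<open>S\<close> have arbitrary values at \<open>a\<close>; these are reset to zero.\<close>
  have extend: "\<exists>ws. \<forall>i\<in>insert a S. \<forall>j\<in>insert a S.
      B i j = (\<Sum>w\<leftarrow>ws. w i * conjugate (w j))"
    if B: "psd_on S B" "\<And>i. i \<in> insert a S \<Longrightarrow> B a i = 0 \<and> B i a = 0" for B :: "'i \<Rightarrow> 'i \<Rightarrow> 'a"
  proof -
    obtain ws where ws: "\<forall>i\<in>S. \<forall>j\<in>S. B i j = (\<Sum>w\<leftarrow>ws. w i * conjugate (w j))"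
      using insert.IH[OF B(1)] by blast
    show ?thesis
      by (rule exI[of _ "map (\<lambda>w. w(a := 0)) ws"])
        (use ws B(2) insert.hyps in \<open>auto simp: o_def intro!: arg_cong[of _ _ sum_list]\<close>)
  qed
  have herm: "A j i = conjugate (A i j)" if "i \<in> insert a S" "j \<in> insert a S" for i j
    using psd_onD(1)[OF insert.prems that] .
  have sub: "psd_on S A" using psd_on_subset[OF insert.prems] insert.hyps by blast
  show ?case
  proof (cases "A a a = 0")
    case True
    have "A a i = 0 \<and> A i a = 0" if "i \<in> insert a S" for i
      using psd_on_zero_diag[OF insert.prems, of a i] True insert.hyps that herm[of a i] by auto
    then show ?thesis using extend[OF sub] by blast
  next
    case False
    have "psd_on {a} A" using psd_on_subset[OF insert.prems, of "{a}"] insert.hyps by simp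
    from psd_onD(2)[OF this, of "\<lambda>_. 1"] have "0 \<le> A a a" by (simp add: hform_def)
    then obtain b where b: "b * conjugate b = A a a" using nonneg_is_square by blast
    with False have "b \<noteq> 0" by auto
    define v where "v = (\<lambda>i. A i a / conjugate b)"
    let ?B = "\<lambda>i j. A i j - v i * conjugate (v j)"
    have "psd_on S ?B"
      unfolding v_def
      using psd_on_schur_complement[OF insert.prems insert.hyps b \<open>b \<noteq> 0\<close>] .
    moreover have "?B a i = 0 \<and> ?B i a = 0" if "i \<in> insert a S" for i
    proof -
      have "v a = b" using \<open>b \<noteq> 0\<close> by (simp add: v_def flip: b)
      moreover have "conjugate (v i) = A a i / b"
        using herm[of i a] that by (simp add: v_def conjugate_divide)
      ultimately show ?thesis using \<open>b \<noteq> 0\<close> by (simp add: v_def)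
    qed
    ultimately obtain ws where
      ws: "\<forall>i\<in>insert a S. \<forall>j\<in>insert a S. ?B i j = (\<Sum>w\<leftarrow>ws. w i * conjugate (w j))"
      using extend by blast
    show ?thesis
      by (rule exI[of _ "v # ws"]) (use ws in \<open>simp add: diff_eq_eq add.commute\<close>)
  qed
qed simp

lemma mat_adjoint_index:
  "i < dim_col A \<Longrightarrow> j < dim_row A \<Longrightarrow> mat_adjoint A $$ (i, j) = conjugate (A $$ (j, i))"
  by (simp add: mat_adjoint_def mat_of_rows_index)

lemma mat_adjoint_eq_iff:
  assumes "A \<in> carrier_mat n n"
  shows "mat_adjoint A = A \<longleftrightarrow> (\<forall>i<n. \<forall>j<n. A $$ (j, i) = conjugate (A $$ (i, j)))"
proof -
  have "dim_row (mat_adjoint A) = n" "dim_col (mat_adjoint A) = n"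
    using assms by (auto simp: mat_adjoint_def)
  then have "mat_adjoint A = A \<longleftrightarrow> (\<forall>i<n. \<forall>j<n. conjugate (A $$ (i, j)) = A $$ (j, i))"
    using assms by (auto simp: mat_eq_iff mat_adjoint_index)
  then show ?thesis by metis
qed

lemma psd_mats_iff:
  fixes A :: "'a :: conjugatable_ordered_field mat"
  shows "A \<in> psd_mats n \<longleftrightarrow> A \<in> carrier_mat n n \<and> psd_on {..<n} (\<lambda>i j. A $$ (i, j))"
proof (cases "A \<in> carrier_mat n n")
  case A: True
  have form: "(A *\<^sub>v v) \<bullet>c v = hform {..<n} (\<lambda>i j. A $$ (i, j)) (($) v)"
    if "v \<in> carrier_vec n" for v
    using A that
    by (auto simp: scalar_prod_def hform_def sum_distrib_right lessThan_atLeast0 intro!: sum.cong)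
  have "hform {..<n} (\<lambda>i j. A $$ (i, j)) x = hform {..<n} (\<lambda>i j. A $$ (i, j)) (($) (vec n x))" for x
    by (auto simp: hform_def intro!: sum.cong)
  then have "(\<forall>v \<in> carrier_vec n. 0 \<le> (A *\<^sub>v v) \<bullet>c v) \<longleftrightarrow>
      (\<forall>x. 0 \<le> hform {..<n} (\<lambda>i j. A $$ (i, j)) x)"
    by (metis form vec_carrier)
  then have "A \<in> psd_mats n \<longleftrightarrow> (\<forall>i<n. \<forall>j<n. A $$ (j, i) = conjugate (A $$ (i, j))) \<and>
      (\<forall>x. 0 \<le> hform {..<n} (\<lambda>i j. A $$ (i, j)) x)"
    unfolding psd_mats_def mem_Collect_eq mat_adjoint_eq_iff[OF A] using A by metis
  then show ?thesis unfolding psd_on_def Ball_def lessThan_iff using A by metis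
qed (simp add: psd_mats_def)

section \<open>Bounded-support decompositions\<close>

lemma foldr_outer_self:
  assumes "\<forall>v\<in>set vs. v \<in> carrier_vec n"
  shows "foldr (+) (map outer_self vs) (0\<^sub>m n n)
    = mat n n (\<lambda>(i, j). \<Sum>v\<leftarrow>vs. v $ i * conjugate (v $ j))"
  using assms by (induction vs) (auto simp: outer_self_def)

lemma width_decomp_iff:
  assumes "A \<in> carrier_mat n n"
  shows "width_decomp k A vs \<longleftrightarrow>
    (\<forall>v\<in>set vs. v \<in> carrier_vec n \<and> card (supp_vec v) \<le> k) \<and>
    (\<forall>i<n. \<forall>j<n. A $$ (i, j) = (\<Sum>v\<leftarrow>vs. v $ i * conjugate (v $ j)))"
  using assms by (auto simp: width_decomp_def foldr_outer_self mat_eq_iff)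

lemma supp_vec_subset: "v \<in> carrier_vec n \<Longrightarrow> supp_vec v \<subseteq> {..<n}"
  by (auto simp: supp_vec_def)

lemma card_supp_vec_le: "v \<in> carrier_vec n \<Longrightarrow> card (supp_vec v) \<le> n"
  using card_mono[OF _ supp_vec_subset] by fastforce

lemma psd_has_width_decomp:
  fixes A :: "'a :: square_closed_field mat"
  assumes "A \<in> psd_mats n"
  shows "\<exists>vs. width_decomp n A vs"
proof -
  have A: "A \<in> carrier_mat n n" "psd_on {..<n} (\<lambda>i j. A $$ (i, j))"
    using assms by (auto simp: psd_mats_iff)
  obtain ws where "\<forall>i<n. \<forall>j<n. A $$ (i, j) = (\<Sum>w\<leftarrow>ws. w i * conjugate (w j))"
    using psd_on_gram[OF _ A(2)] by auto
  then have "width_decomp n A (map (vec n) ws)"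
    by (auto simp: width_decomp_iff[OF A(1)] card_supp_vec_le o_def
        intro!: arg_cong[of _ _ sum_list])
  then show ?thesis ..
qed

text \<open>
  The maximum is there for the empty matrix, whose factor width is 1 because factor widths are
  positive by definition.
\<close>

lemma
  fixes A :: "'a :: square_closed_field mat"
  assumes A: "A \<in> psd_mats n"
  shows factor_width_decomp: "\<exists>vs. width_decomp (factor_width A) A vs"
    and factor_width_le: "factor_width A \<le> max 1 n"
proof -
  have w: "0 < max 1 n \<and> (\<exists>vs. width_decomp (max 1 n) A vs)"
    using psd_has_width_decomp[OF A] by (fastforce simp: width_decomp_def)
  show "\<exists>vs. width_decomp (factor_width A) A vs"
    unfolding factor_width_def using LeastI[of "\<lambda>k. 0 < k \<and> (\<exists>vs. width_decomp k A vs)", OF w] by blast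
  show "factor_width A \<le> max 1 n"
    unfolding factor_width_def
    using Least_le[of "\<lambda>k. 0 < k \<and> (\<exists>vs. width_decomp k A vs)", OF w] .
qed

section \<open>The lower bound\<close>

text \<open>
  A non-zero entry \<open>A\<^sub>i\<^sub>j\<close> has a non-zero summand \<open>v\<^sub>i * conjugate v\<^sub>j\<close>, so the supports of the
  vectors cover all pairs. The bound \<open>k \<le> n\<close> leaves room to enlarge them to \<open>k\<close> points.
\<close>

lemma covering_number_le_length:
  fixes A :: "'a :: conjugatable_field mat"
  assumes A: "A \<in> carrier_mat n n" "nonzero_entries A" and vs: "width_decomp k A vs" and "k \<le> n"
  shows "covering_number n k 2 \<le> length vs"
proof -
  note vs' = vs[unfolded width_decomp_iff[OF A(1)]]
  have "\<exists>B. supp_vec v \<subseteq> B \<and> B \<subseteq> {..<n} \<and> card B = k" if "v \<in> set vs" for v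
    using vs' that \<open>k \<le> n\<close> by (intro exists_subset_between) (auto simp: supp_vec_def)
  then obtain B where B: "\<And>v. v \<in> set vs \<Longrightarrow> supp_vec v \<subseteq> B v \<and> B v \<subseteq> {..<n} \<and> card (B v) = k"
    by metis
  have "covering_design n k 2 (B ` set vs)"
    unfolding covering_design_def
  proof (intro conjI allI impI)
    fix T :: "nat set" assume T: "T \<subseteq> {..<n} \<and> card T = 2"
    then obtain i j where ij: "T = {i, j}" by (auto simp: card_2_iff)
    with T A have "A $$ (i, j) \<noteq> 0" by (auto simp: nonzero_entries_def)
    then have "(\<Sum>v\<leftarrow>vs. v $ i * conjugate (v $ j)) \<noteq> 0" using vs' T ij by auto
    then obtain v where v: "v \<in> set vs" "v $ i * conjugate (v $ j) \<noteq> 0"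
      by (metis (no_types, lifting) map_eq_conv sum_list_0)
    then have "T \<subseteq> supp_vec v" using ij T vs' by (auto simp: supp_vec_def)
    then show "\<exists>C\<in>B ` set vs. T \<subseteq> C" using v B by blast
  qed (use B in auto)
  then have "covering_number n k 2 \<le> card (B ` set vs)"
    unfolding covering_number_def by (intro Least_le) blast
  also have "\<dots> \<le> length vs" by (meson card_image_le card_length finite_set le_trans)
  finally show ?thesis .
qed

lemma covering_number_le_fran:
  fixes A :: "'a :: square_closed_field mat"
  assumes A: "A \<in> psd_mats n" "nonzero_entries A" and k: "factor_width A = k" "2 \<le> k"
  shows "covering_number n k 2 \<le> fran k A"
proof -
  have "k \<le> n" using factor_width_le[OF A(1)] k by simp
  obtain vs0 where "width_decomp k A vs0" using factor_width_decomp[OF A(1)] k by blast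
  then obtain vs where "width_decomp k A vs" "length vs = fran k A"
    unfolding fran_def using LeastI_ex[of "\<lambda>r. \<exists>vs. width_decomp k A vs \<and> length vs = r"] by blast
  moreover have "A \<in> carrier_mat n n" using A by (simp add: psd_mats_iff)
  ultimately show ?thesis using covering_number_le_length[of A n k vs] A(2) \<open>k \<le> n\<close> by simp
qed

section \<open>A test for large factor width\<close>

text \<open>
  This is the functional \<open>L\<close> of the introduction, written without reference to \<open>card S\<close>. In this
  form it takes the value \<open>(\<Sum>i\<in>S. \<Sum>j\<in>S. \<bar>w\<^sub>i - w\<^sub>j\<bar>\<^sup>2) - 2 (\<Sum>i\<in>S. \<bar>w\<^sub>i\<bar>\<^sup>2)\<close> at \<open>w w\<^sup>*\<close>, from which its sign
  is visible. The factor 2 keeps the double sum symmetric in \<open>i\<close> and \<open>j\<close>.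
\<close>

definition width_test :: "'i set \<Rightarrow> ('i \<Rightarrow> 'i \<Rightarrow> 'a :: comm_ring_1) \<Rightarrow> 'a" where
  "width_test S A = (\<Sum>i\<in>S. \<Sum>j\<in>S. A i i + A j j - A i j - A j i) - 2 * (\<Sum>i\<in>S. A i i)"

lemma width_test_cong:
  assumes "\<And>i j. i \<in> S \<Longrightarrow> j \<in> S \<Longrightarrow> A i j = B i j"
  shows "width_test S A = width_test S B"
  unfolding width_test_def using assms by simp

lemma width_test_sum_list:
  "width_test S (\<lambda>i j. \<Sum>x\<leftarrow>xs. f x i j) = (\<Sum>x\<leftarrow>xs. width_test S (f x))"
proof (induction xs)
  case (Cons x xs)
  have "width_test S (\<lambda>i j. f x i j + g i j) = width_test S (f x) + width_test S g" for g
    by (simp add: width_test_def sum.distrib sum_subtractf algebra_simps)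
  with Cons show ?case by simp
qed (simp add: width_test_def)

text \<open>
  The terms of the double sum with \<open>i = p\<close> or \<open>j = p\<close> are \<open>\<bar>w\<^sub>j\<bar>\<^sup>2\<close> and \<open>\<bar>w\<^sub>i\<bar>\<^sup>2\<close>; they cancel the
  negative part exactly.
\<close>

lemma width_test_nonneg:
  fixes w :: "'i \<Rightarrow> 'a :: square_closed_field"
  assumes "finite S" "p \<in> S" "w p = 0"
  shows "0 \<le> width_test S (\<lambda>i j. w i * conjugate (w j))"
proof -
  let ?d = "\<lambda>i j. (w i - w j) * conjugate (w i - w j)"
  have d: "0 \<le> ?d i j" for i j by (rule conjugate_square_positive)
  define S' where "S' = S - {p}"
  have S: "S = insert p S'" "p \<notin> S'" "finite S'" using assms by (auto simp: S'_def)
  have "width_test S (\<lambda>i j. w i * conjugate (w j))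
      = (\<Sum>i\<in>S. \<Sum>j\<in>S. ?d i j) - 2 * (\<Sum>i\<in>S. w i * conjugate (w i))"
    by (simp add: width_test_def conjugate_diff algebra_simps)
  also have "\<dots> = (\<Sum>i\<in>S'. \<Sum>j\<in>S'. ?d i j)"
    using S assms(3) by (simp add: sum.distrib conjugate_neg)
  finally show ?thesis by (simp add: sum_nonneg d)
qed

text \<open>A vector with at most \<open>k < card S\<close> non-zero entries must vanish at some point of \<open>S\<close>.\<close>

lemma width_test_nonneg_if_width_decomp:
  fixes A :: "'a :: square_closed_field mat"
  assumes "A \<in> carrier_mat n n" "width_decomp k A vs" "S \<subseteq> {..<n}" "k < card S"
  shows "0 \<le> width_test S (\<lambda>i j. A $$ (i, j))"
proof -
  note vs = assms(2)[unfolded width_decomp_iff[OF assms(1)]]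
  have fin: "finite S" using assms(3) finite_subset by blast
  have A: "A $$ (i, j) = (\<Sum>v\<leftarrow>vs. v $ i * conjugate (v $ j))" if "i \<in> S" "j \<in> S" for i j
    using vs that assms(3) by auto
  have "0 \<le> width_test S (\<lambda>i j. v $ i * conjugate (v $ j))" if "v \<in> set vs" for v
  proof -
    have "finite (supp_vec v)" by (simp add: supp_vec_def)
    then have "\<not> S \<subseteq> supp_vec v" using card_mono[of "supp_vec v" S] vs that assms(4) by force
    then obtain p where "p \<in> S" "p \<notin> supp_vec v" by blast
    moreover have "dim_vec v = n" using vs that by auto
    ultimately have "p \<in> S" "v $ p = 0" using assms(3) by (auto simp: supp_vec_def)
    then show ?thesis using width_test_nonneg[OF fin, of p "($) v"] by simp
  qed
  then have "0 \<le> (\<Sum>v\<leftarrow>vs. width_test S (\<lambda>i j. v $ i * conjugate (v $ j)))"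
    by (intro sum_list_nonneg) auto
  also have "\<dots> = width_test S (\<lambda>i j. A $$ (i, j))"
    unfolding width_test_sum_list[symmetric] by (rule width_test_cong) (simp add: A)
  finally show ?thesis .
qed

section \<open>The extremal matrices\<close>

lemma ex_covering_design:
  assumes "2 \<le> k" "k \<le> n"
  shows "\<exists>\<B>. covering_design n k 2 \<B> \<and> card \<B> = covering_number n k 2"
proof -
  have "covering_design n k 2 {B. B \<subseteq> {..<n} \<and> card B = k}"
    unfolding covering_design_def
  proof (intro conjI allI impI)
    fix T :: "nat set" assume "T \<subseteq> {..<n} \<and> card T = 2"
    then have "\<exists>B. T \<subseteq> B \<and> B \<subseteq> {..<n} \<and> card B = k"
      using assms by (intro exists_subset_between) auto
    then show "\<exists>B\<in>{B. B \<subseteq> {..<n} \<and> card B = k}. T \<subseteq> B" by auto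
  qed simp
  then show ?thesis unfolding covering_number_def
    using LeastI_ex[of "\<lambda>c. \<exists>\<B>. covering_design n k 2 \<B> \<and> card \<B> = c"] by blast
qed

lemma psd_if_width_decomp:
  fixes A :: "'a :: square_closed_field mat"
  assumes A: "A \<in> carrier_mat n n" and vs: "width_decomp k A vs"
  shows "A \<in> psd_mats n"
proof -
  have ent: "A $$ (i, j) = (\<Sum>v\<leftarrow>vs. v $ i * conjugate (v $ j))" if "i < n" "j < n" for i j
    using vs that by (auto simp: width_decomp_iff[OF A])
  have "(\<Sum>v\<leftarrow>us. v $ j * conjugate (v $ i)) = conjugate (\<Sum>v\<leftarrow>us. v $ i * conjugate (v $ j))"
    for us :: "'a vec list" and i j
    by (induction us) (simp_all add: conjugate_dist_add conjugate_dist_mul mult.commute)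
  then have "A $$ (j, i) = conjugate (A $$ (i, j))" if "i < n" "j < n" for i j
    unfolding ent[OF that] ent[OF that(2,1)] .
  moreover have "0 \<le> hform {..<n} (\<lambda>i j. \<Sum>v\<leftarrow>us. v $ i * conjugate (v $ j)) x"
    for us :: "'a vec list" and x
  proof (induction us)
    case (Cons v us)
    define t where "t = (\<Sum>i<n. v $ i * conjugate (x i))"
    have "hform {..<n} (\<lambda>i j. v $ i * conjugate (v $ j)) x = t * conjugate t"
      unfolding hform_def t_def sum_conjugate[OF finite_lessThan] sum_product
      by (simp only: conjugate_dist_mul conjugate_id mult_ac)
    then have "hform {..<n} (\<lambda>i j. \<Sum>v\<leftarrow>v # us. v $ i * conjugate (v $ j)) x
        = t * conjugate t + hform {..<n} (\<lambda>i j. \<Sum>v\<leftarrow>us. v $ i * conjugate (v $ j)) x"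
      by (simp add: hform_def sum.distrib distrib_right)
    with Cons show ?case by (simp add: conjugate_square_positive)
  qed (simp add: hform_def)
  then have "0 \<le> hform {..<n} (\<lambda>i j. A $$ (i, j)) x" for x
    by (simp add: hform_def ent)
  ultimately show ?thesis using A unfolding psd_mats_iff psd_on_def by blast
qed

lemma width_test_of_int:
  "width_test S (\<lambda>i j. of_int (f i j)) = of_int (width_test S f)"
  by (simp add: width_test_def)

text \<open>
  The matrix is \<open>c\<^sup>2\<close> times the matrix of ones on one block \<open>S\<close>, plus the matrices of ones on all the
  other blocks of a minimum covering design. The test value is \<open>- 2 k c\<^sup>2\<close> on the first part and an
  integer that does not depend on \<open>c\<close> on the second, so any sufficiently large integer \<open>c\<close> forces
  factor width \<open>k\<close>.
\<close>

lemma ex_extremal_matrix: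
  assumes k: "2 \<le> k" "k \<le> n"
  shows "\<exists>A :: 'a :: square_closed_field mat. A \<in> psd_mats n \<and> factor_width A = k \<and>
    nonzero_entries A \<and> fran k A = covering_number n k 2"
proof -
  obtain \<B> where \<B>: "covering_design n k 2 \<B>" "card \<B> = covering_number n k 2"
    using ex_covering_design[OF k] by blast
  have "finite \<B>" using \<B>(1) unfolding covering_design_def
    by (intro finite_subset[of \<B> "Pow {..<n}"]) auto
  \<comment> \<open>The case \<open>i = j\<close> is included: it yields the diagonal entries and that \<open>\<B>\<close> is not empty.\<close>
  have cover: "\<exists>B\<in>\<B>. i \<in> B \<and> j \<in> B" if "i < n" "j < n" for i j
  proof -
    have "card {i, j} \<le> 2" by (simp add: card_insert_if)
    then obtain T where T: "{i, j} \<subseteq> T" "T \<subseteq> {..<n}" "card T = 2"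
      using exists_subset_between[of "{i, j}" 2 "{..<n}"] k \<open>i < n\<close> \<open>j < n\<close> by auto
    have "\<exists>B\<in>\<B>. T \<subseteq> B"
      using conjunct2[OF \<B>(1)[unfolded covering_design_def], rule_format, of T] T(2,3) by simp
    then show ?thesis using T(1) by auto
  qed
  obtain S where S: "S \<in> \<B>" using cover[of 0 0] k by auto
  obtain bs where bs: "set bs = \<B> - {S}" "distinct bs"
    using finite_distinct_list[of "\<B> - {S}"] \<open>finite \<B>\<close> by auto
  have len: "Suc (length bs) = covering_number n k 2"
    using S \<B>(2) \<open>finite \<B>\<close> distinct_card[OF bs(2)] bs(1)
    by (metis card_Suc_Diff1)
  have block: "B \<subseteq> {..<n} \<and> card B = k" if "B \<in> \<B>" for B
    using \<B>(1) that by (auto simp: covering_design_def)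
  \<comment> \<open>All entries are integers, so the matrices are first described over \<open>int\<close>: \<open>M\<close> is the part that
    comes from the blocks other than \<open>S\<close>, and \<open>N\<close> is the whole matrix.\<close>
  define M :: "nat \<Rightarrow> nat \<Rightarrow> int" where "M = (\<lambda>i j. \<Sum>B\<leftarrow>bs. of_bool (i \<in> B \<and> j \<in> B))"
  define c where "c = nat \<bar>width_test S M\<bar> + 1"
  define N where "N = (\<lambda>i j. (int c)\<^sup>2 * of_bool (i \<in> S \<and> j \<in> S) + M i j)"
  define A :: "'a mat" where "A = mat n n (\<lambda>(i, j). of_int (N i j))"
  have A: "A \<in> carrier_mat n n" by (simp add: A_def)
  define vs :: "'a vec list" where
    "vs = vec n (\<lambda>i. of_nat c * of_bool (i \<in> S)) # map (\<lambda>B. vec n (\<lambda>i. of_bool (i \<in> B))) bs"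
  have cpos: "c > 0" by (simp add: c_def)

  have supp: "supp_vec (vec n (\<lambda>i. z * of_bool (i \<in> B))) = B"
    if "B \<subseteq> {..<n}" "z \<noteq> 0" for B and z :: 'a
    using that by (auto simp: supp_vec_def)
  have "card (supp_vec v) \<le> k" if "v \<in> set vs" for v
  proof -
    obtain z :: 'a and B where "v = vec n (\<lambda>i. z * of_bool (i \<in> B))" "z \<noteq> 0" "B \<in> \<B>"
    proof (cases "v = hd vs")
      case True
      show ?thesis by (rule that[of "of_nat c" S]) (use True S cpos in \<open>simp_all add: vs_def\<close>)
    next
      case False
      with \<open>v \<in> set vs\<close> obtain B where "B \<in> \<B>" "v = vec n (\<lambda>i. of_bool (i \<in> B))"
        using bs(1) unfolding vs_def by fastforce
      then show ?thesis by (intro that[of 1 B]) simp_all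
    qed
    then show ?thesis using supp[of B z] block[of B] by simp
  qed
  moreover have "of_int (N i j) = (\<Sum>v\<leftarrow>vs. v $ i * conjugate (v $ j))" if "i < n" "j < n" for i j
  proof -
    have M_list: "(of_int (\<Sum>B\<leftarrow>Bs. of_bool (i \<in> B \<and> j \<in> B)) :: 'a)
        = (\<Sum>B\<leftarrow>Bs. of_bool (i \<in> B) * conjugate (of_bool (j \<in> B)))" for Bs
      by (induction Bs) (simp_all add: of_bool_def)
    have "(of_int ((int c)\<^sup>2 * of_bool (i \<in> S \<and> j \<in> S)) :: 'a)
        = (of_nat c * of_bool (i \<in> S)) * conjugate (of_nat c * of_bool (j \<in> S))"
      by (simp add: of_bool_def power2_eq_square)
    then have "of_int (N i j) = (of_nat c * of_bool (i \<in> S)) * conjugate (of_nat c * of_bool (j \<in> S))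
        + (\<Sum>B\<leftarrow>bs. of_bool (i \<in> B) * conjugate (of_bool (j \<in> B) :: 'a))"
      unfolding N_def M_def of_int_add M_list by (rule arg_cong)
    then show ?thesis using that by (simp add: vs_def o_def)
  qed
  ultimately have dec: "width_decomp k A vs"
    using block S bs(1) unfolding width_decomp_iff[OF A] by (auto simp: A_def vs_def)
  have psd: "A \<in> psd_mats n" by (rule psd_if_width_decomp[OF A dec])

  have "N i j \<noteq> 0" if ij: "i < n" "j < n" for i j
  proof -
    have M0: "0 \<le> M i j" unfolding M_def by (intro sum_list_nonneg) auto
    obtain B where B: "B \<in> \<B>" "i \<in> B" "j \<in> B" using cover[OF ij] by blast
    show ?thesis
    proof (cases "B = S")
      case True
      have "0 < (int c)\<^sup>2" using cpos by simp
      moreover have "N i j = (int c)\<^sup>2 + M i j" using True B by (simp add: N_def)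
      ultimately show ?thesis using M0 by linarith
    next
      case False
      then have "B \<in> set bs" using B bs(1) by simp
      then obtain xs ys where "bs = xs @ B # ys" using split_list by metis
      then have "M i j = (\<Sum>B\<leftarrow>xs. of_bool (i \<in> B \<and> j \<in> B)) + 1
          + (\<Sum>B\<leftarrow>ys. of_bool (i \<in> B \<and> j \<in> B))"
        using B by (simp add: M_def)
      moreover have "0 \<le> (\<Sum>B\<leftarrow>zs. of_bool (i \<in> B \<and> j \<in> B) :: int)" for zs
        by (intro sum_list_nonneg) auto
      ultimately have "1 \<le> M i j" by (smt (verit))
      moreover have "0 \<le> (int c)\<^sup>2 * of_bool (i \<in> S \<and> j \<in> S)" by simp
      ultimately show ?thesis unfolding N_def by linarith
    qed
  qed
  then have nz: "nonzero_entries A" by (simp add: nonzero_entries_def A_def)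

  have "width_test S N = width_test S M - 2 * int k * (int c)\<^sup>2"
    using block[OF S] by (simp add: width_test_def N_def sum.distrib sum_subtractf algebra_simps)
  moreover have "int c \<le> (int c)\<^sup>2" using cpos by (simp add: power2_eq_square)
  moreover have "(int c)\<^sup>2 \<le> 2 * int k * (int c)\<^sup>2" using k by (simp add: mult_le_cancel_right1)
  moreover have "width_test S M < int c" by (simp add: c_def)
  ultimately have neg: "width_test S N < 0" by linarith
  have "width_test S (\<lambda>i j. A $$ (i, j)) = width_test S (\<lambda>i j. of_int (N i j))"
  proof (rule width_test_cong)
    fix i j assume "i \<in> S" "j \<in> S"
    then have "i < n" "j < n" using block[OF S] by auto
    then show "A $$ (i, j) = of_int (N i j)" by (simp add: A_def)
  qed
  with neg have not_nonneg: "\<not> 0 \<le> width_test S (\<lambda>i j. A $$ (i, j))"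
    by (simp add: width_test_of_int of_int_nonneg_iff_in_field)
  have width: "factor_width A = k" unfolding factor_width_def
  proof (rule Least_equality)
    show "0 < k \<and> (\<exists>vs. width_decomp k A vs)" using k dec by auto
  next
    fix l assume "0 < l \<and> (\<exists>vs. width_decomp l A vs)"
    then obtain us where us: "width_decomp l A us" by blast
    have "\<not> l < card S"
      using width_test_nonneg_if_width_decomp[OF A us, of S] block[OF S] not_nonneg by metis
    then show "k \<le> l" using block[OF S] by simp
  qed
  have "length vs = covering_number n k 2" using len by (simp add: vs_def)
  then have "fran k A \<le> covering_number n k 2"
    unfolding fran_def using dec Least_le[of "\<lambda>r. \<exists>vs. width_decomp k A vs \<and> length vs = r"] by blast
  then have "fran k A = covering_number n k 2"
    using covering_number_le_fran[OF psd nz width k(1)] by simp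
  then show ?thesis using psd nz width by blast
qed

theorem proposition6:
  shows
    "(\<forall>(n::nat) (k::nat) (A :: real mat).
        A \<in> psd_mats n \<and> factor_width A = k \<and> 2 \<le> k \<and> nonzero_entries A \<longrightarrow>
        covering_number n k 2 \<le> fran k A) \<and>
     (\<forall>(n::nat) (k::nat). 2 \<le> k \<and> k \<le> n \<longrightarrow>
        (\<exists>A :: real mat. A \<in> psd_mats n \<and> factor_width A = k \<and> nonzero_entries A \<and>
           fran k A = covering_number n k 2)) \<and>
     (\<forall>(n::nat) (k::nat) (A :: complex mat).
        A \<in> psd_mats n \<and> factor_width A = k \<and> 2 \<le> k \<and> nonzero_entries A \<longrightarrow>
        covering_number n k 2 \<le> fran k A) \<and>
     (\<forall>(n::nat) (k::nat). 2 \<le> k \<and> k \<le> n \<longrightarrow>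
        (\<exists>A :: complex mat. A \<in> psd_mats n \<and> factor_width A = k \<and> nonzero_entries A \<and>
           fran k A = covering_number n k 2))"
  by (intro conjI allI impI; (elim conjE)?;
      (rule covering_number_le_fran ex_extremal_matrix; assumption))

end
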